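(* Let $\alpha=\alpha(t)$, $t\in I_1$, and $\omega=\omega(s)$, $s\in I_2$, be regular planar curves with values in $\mathbb{C}\setminus\{0\}$ ($I_1,I_2$ intervals of $\mathbb{R}$), let $\Phi=\alpha\ast\omega$ be the associated Lagrangian immersion, and let $\rho>0$, $\theta\in\mathbb{R}$. Then $\Phi$ is a translating soliton for mean curvature flow with translating vector $\mathbf{e}=(\rho\,e^{i\theta},0)\in\mathbb{C}^2$ if and only if the planar curves $\alpha$ and $\omega$ satisfy $$|\alpha'|\kappa_\alpha=\rho\,\mathrm{Im}\left(e^{-i\theta}\alpha'\overline{\alpha}\right),\qquad |\dot\omega|\kappa_\omega=-\rho\,\mathrm{Im}\left(e^{-i\theta}\dot\omega\,\overline{\omega}\right).$$
   Context: For base points $t_0\in I_1,s_0\in I_2$, $$(\alpha\ast\omega)(t,s)=\left(\int_{s_0}^s\dot\omega(y)\overline{\omega(y)}\,dy-\int_{t_0}^t\alpha'(x)\overline{\alpha(x)}\,dx\, ,\ \alpha(t)\omega(s)\right)\in\mathbb{C}^2,$$ where $'$ and $\dot{}$ denote derivatives in $t$ and $s$; changing base points only changes the map by a translation. It is a Lagrangian immersion (the Kaehler form $-\mathrm{Im}(z_1\bar w_1+z_2\bar w_2)$ pulls back to zero) with induced metric $(|\alpha|^2+|\omega|^2)(|\alpha'|^2dt^2+|\dot\omega|^2ds^2)$. $\kappa_\alpha,\kappa_\omega$ are the signed curvatures, so $(\arg\alpha')'=|\alpha'|\kappa_\alpha$ and $(\arg\dot\omega)\dot{}=|\dot\omega|\kappa_\omega$.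 An immersion of a surface in $\mathbb{R}^4\equiv\mathbb{C}^2$ is a translating soliton for mean curvature flow with translating vector $\mathbf{e}$ (a nonzero constant vector) if $H=\mathbf{e}^\perp$. Here $H=\mathrm{trace}\,\sigma$ is the mean curvature vector ($\sigma$ the second fundamental form, no factor $1/2$) and $\mathbf{e}^\perp$ is the normal projection of $\mathbf{e}$. *)

theory Defs
  imports "HOL-Analysis.Analysis"
begin

text \<open>
  The space \<open>\<complex>\<^sup>2\<close>, identified with \<open>\<real>\<^sup>4\<close>, is the Euclidean space \<^typ>\<open>complex \<times> complex\<close>; its library
  inner product is \<open>Re (z\<^sub>1 * cnj w\<^sub>1 + z\<^sub>2 * cnj w\<^sub>2)\<close>.

  All derivatives are taken within the domain. Intervals may thus contain their end points, where
  derivatives are one-sided; on open intervals these are the usual derivatives.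
\<close>

primrec Ck_on :: "nat \<Rightarrow> 'a::euclidean_space set \<Rightarrow> ('a \<Rightarrow> 'b::real_normed_vector) \<Rightarrow> bool" where
  "Ck_on 0 S f = continuous_on S f"
| "Ck_on (Suc k) S f =
     (\<exists>f'. (\<forall>x\<in>S. (f has_derivative f' x) (at x within S)) \<and>
           (\<forall>b\<in>Basis. Ck_on k S (\<lambda>x. f' x b)))"


subsection \<open>Planar curves\<close>

definition velocity :: "real set \<Rightarrow> (real \<Rightarrow> complex) \<Rightarrow> real \<Rightarrow> complex" where
  "velocity I \<alpha> t = vector_derivative \<alpha> (at t within I)"

definition acceleration :: "real set \<Rightarrow> (real \<Rightarrow> complex) \<Rightarrow> real \<Rightarrow> complex" where
  "acceleration I \<alpha> = velocity I (velocity I \<alpha>)"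

text \<open>Class \<open>C\<^sup>2\<close> is the regularity at which curvatures (of curves and of surfaces) make sense.\<close>

definition regular_curve :: "real set \<Rightarrow> (real \<Rightarrow> complex) \<Rightarrow> bool" where
  "regular_curve I \<alpha> \<longleftrightarrow> Ck_on 2 I \<alpha> \<and> (\<forall>t\<in>I. velocity I \<alpha> t \<noteq> 0)"

text \<open>
  \<open>det (\<alpha>', \<alpha>'') / |\<alpha>'|\<^sup>3\<close>, with the sign for which the argument of \<open>\<alpha>'\<close> has derivative
  \<open>|\<alpha>'| * \<kappa>\<close>.
\<close>

definition signed_curvature :: "real set \<Rightarrow> (real \<Rightarrow> complex) \<Rightarrow> real \<Rightarrow> real" where
  "signed_curvature I \<alpha> t =
     Im (cnj (velocity I \<alpha> t) * acceleration I \<alpha> t) / norm (velocity I \<alpha> t) ^ 3"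


subsection \<open>Surfaces parametrized over a rectangle \<open>I \<times> J\<close>\<close>

definition partial1 :: "real set \<Rightarrow> (real \<times> real \<Rightarrow> 'b::real_normed_vector) \<Rightarrow> real \<times> real \<Rightarrow> 'b" where
  "partial1 I F p = vector_derivative (\<lambda>x. F (x, snd p)) (at (fst p) within I)"

definition partial2 :: "real set \<Rightarrow> (real \<times> real \<Rightarrow> 'b::real_normed_vector) \<Rightarrow> real \<times> real \<Rightarrow> 'b" where
  "partial2 J F p = vector_derivative (\<lambda>y. F (fst p, y)) (at (snd p) within J)"

definition immersion_on ::
  "real set \<Rightarrow> real set \<Rightarrow> (real \<times> real \<Rightarrow> 'b::euclidean_space) \<Rightarrow> bool" where
  "immersion_on I J F \<longleftrightarrow>
     Ck_on 2 (I \<times> J) F \<and>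
     (\<forall>p\<in>I \<times> J. \<exists>F'. (F has_derivative F') (at p within I \<times> J) \<and> inj F')"

definition tangent_space ::
  "real set \<Rightarrow> real set \<Rightarrow> (real \<times> real \<Rightarrow> 'b::euclidean_space) \<Rightarrow> real \<times> real \<Rightarrow> 'b set" where
  "tangent_space I J F p = span {partial1 I F p, partial2 J F p}"

definition normal_projection ::
  "real set \<Rightarrow> real set \<Rightarrow> (real \<times> real \<Rightarrow> 'b::euclidean_space) \<Rightarrow> real \<times> real \<Rightarrow> 'b \<Rightarrow> 'b" where
  "normal_projection I J F p v =
     (THE n. n \<in> (tangent_space I J F p)\<^sup>\<bottom> \<and> v - n \<in> tangent_space I J F p)"

text \<open>
  The trace of the second fundamental form \<open>\<sigma>\<close> with respect to the induced metric
  \<open>g\<^sub>1\<^sub>1 dt\<^sup>2 + 2 g\<^sub>1\<^sub>2 dt ds + g\<^sub>2\<^sub>2 ds\<^sup>2\<close>, i.e. \<open>\<Sum>i j. g\<^sup>i\<^sup>j \<sigma>\<^sub>i\<^sub>j\<close> with the inverse matrix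
  \<open>(g\<^sup>i\<^sup>j)\<close> written out. In Euclidean space \<open>\<sigma>\<^sub>i\<^sub>j\<close> is the normal part of the second partial
  derivative.
\<close>

definition mean_curvature_vector ::
  "real set \<Rightarrow> real set \<Rightarrow> (real \<times> real \<Rightarrow> 'b::euclidean_space) \<Rightarrow> real \<times> real \<Rightarrow> 'b" where
  "mean_curvature_vector I J F p =
    (let g11 = partial1 I F p \<bullet> partial1 I F p;
         g12 = partial1 I F p \<bullet> partial2 J F p;
         g22 = partial2 J F p \<bullet> partial2 J F p;
         \<sigma>11 = normal_projection I J F p (partial1 I (partial1 I F) p);
         \<sigma>12 = normal_projection I J F p (partial1 I (partial2 J F) p);
         \<sigma>22 = normal_projection I J F p (partial2 J (partial2 J F) p)
     in (g22 *\<^sub>R \<sigma>11 - (2 * g12) *\<^sub>R \<sigma>12 + g11 *\<^sub>R \<sigma>22) /\<^sub>R (g11 * g22 - g12\<^sup>2))"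

definition translating_soliton ::
  "real set \<Rightarrow> real set \<Rightarrow> (real \<times> real \<Rightarrow> 'b::euclidean_space) \<Rightarrow> 'b \<Rightarrow> bool" where
  "translating_soliton I J F e \<longleftrightarrow>
     e \<noteq> 0 \<and> immersion_on I J F \<and>
     (\<forall>p\<in>I \<times> J. mean_curvature_vector I J F p = normal_projection I J F p e)"


subsection \<open>The product of two planar curves\<close>

text \<open>The interval integrals are oriented: they change sign when the bounds are swapped.\<close>

definition curve_product ::
  "real set \<Rightarrow> real set \<Rightarrow> real \<Rightarrow> real \<Rightarrow> (real \<Rightarrow> complex) \<Rightarrow> (real \<Rightarrow> complex)
    \<Rightarrow> real \<times> real \<Rightarrow> complex \<times> complex" where
  "curve_product I J t0 s0 \<alpha> \<omega> = (\<lambda>(t, s).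
     ((LBINT y=s0..s. velocity J \<omega> y * cnj (\<omega> y)) - (LBINT x=t0..t. velocity I \<alpha> x * cnj (\<alpha> x)),
      \<alpha> t * \<omega> s))"

end

theory Submission
  imports Defs
begin

text \<open>
  With \<open>X = \<alpha>' (-cnj \<alpha>, \<omega>)\<close> and \<open>Y = \<omega>' (cnj \<omega>, \<alpha>)\<close> the tangent vectors of \<open>\<Phi> = \<alpha> * \<omega>\<close> are \<open>X, Y\<close>; they
  are orthogonal for the Hermitian product, so every vector of \<open>\<complex>\<^sup>2\<close> is \<open>p X + q Y\<close> with complex \<open>p, q\<close>, and it
  is tangent iff \<open>p, q\<close> are real. Since the metric is diagonal, \<open>H\<close> is the normal part of
  \<open>W = \<Phi>\<^sub>t\<^sub>t / g\<^sub>1\<^sub>1 + \<Phi>\<^sub>s\<^sub>s / g\<^sub>2\<^sub>2\<close>, so \<open>H = e\<^sup>\<bottom>\<close> says that \<open>W - e\<close> is tangent. The contributions of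
  \<open>\<alpha>' cnj \<alpha>'\<close> and \<open>\<omega>' cnj \<omega>'\<close> to \<open>W\<close> cancel, and the imaginary parts of the two coefficients of \<open>W - e\<close> give
  one equation for \<open>\<alpha>\<close> and one for \<open>\<omega>\<close>.
\<close>

subsection \<open>Calculus on intervals\<close>

text \<open>A connected set with more than one point has no isolated point. This gives uniqueness of
  derivatives taken within the interval, also at its end points, so that
  \<open>vector_derivative\<close> can be evaluated.\<close>

lemma at_within_interval_neq_bot:
  fixes I :: "real set"
  assumes "is_interval I" "interior I \<noteq> {}" "t \<in> I"
  shows "at t within I \<noteq> bot"
proof -
  have "connected I" using assms(1) by (simp add: is_interval_connected_1)
  moreover have "I \<noteq> {t}" using assms(2) by auto
  ultimately show ?thesis
    using connected_imp_perfect[of I t] assms(3) by (auto simp: trivial_limit_within)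
qed

lemma Ck_on_cong:
  assumes "\<And>x. x \<in> S \<Longrightarrow> f x = g x"
  shows "Ck_on k S f = Ck_on k S g"
proof (cases k)
  case 0
  then show ?thesis using assms by (simp cong: continuous_on_cong)
next
  case (Suc m)
  have "(f has_derivative D) (at x within S) = (g has_derivative D) (at x within S)"
    if "x \<in> S" for x D
    using has_derivative_transform[OF that] assms by metis
  then show ?thesis by (auto simp: Suc)
qed

lemma Ck_on_imp_continuous_on: "Ck_on k S f \<Longrightarrow> continuous_on S f"
  by (cases k) (auto simp: continuous_on_eq_continuous_within intro: has_derivative_continuous)

text \<open>A linear map on the reals is determined by its value at 1, and derivatives within a
  nondegenerate interval are unique. Hence the derivative that \<open>Ck_on\<close> merely asserts
  to exist is \<open>velocity\<close>. Two applications reach the acceleration.\<close>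

lemma Ck_on_Suc_velocity:
  assumes I: "is_interval I" "interior I \<noteq> {}" and C: "Ck_on (Suc k) I \<alpha>"
  shows "Ck_on k I (velocity I \<alpha>)"
    and "\<And>t. t \<in> I \<Longrightarrow> (\<alpha> has_vector_derivative velocity I \<alpha> t) (at t within I)"
proof -
  obtain D where D: "\<And>t. t \<in> I \<Longrightarrow> (\<alpha> has_derivative D t) (at t within I)"
    and CD: "Ck_on k I (\<lambda>t. D t 1)"
    using C by (auto simp only: Ck_on.simps Basis_real_def)
  have *: "(\<alpha> has_vector_derivative D t 1) (at t within I)" if "t \<in> I" for t
  proof -
    have "D t h = h *\<^sub>R D t 1" for h
      using linear_scale[OF has_derivative_linear[OF D[OF that]], of h 1] by simp
    then have "D t = (\<lambda>h. h *\<^sub>R D t 1)" by (rule ext)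
    then show ?thesis using D[OF that] unfolding has_vector_derivative_def by metis
  qed
  have v: "velocity I \<alpha> t = D t 1" if "t \<in> I" for t
    unfolding velocity_def
    by (rule vector_derivative_within[OF at_within_interval_neq_bot[OF I that] *[OF that]])
  show "Ck_on k I (velocity I \<alpha>)"
    using CD Ck_on_cong[of I "velocity I \<alpha>" "\<lambda>t. D t 1", OF v] by simp
  show "\<And>t. t \<in> I \<Longrightarrow> (\<alpha> has_vector_derivative velocity I \<alpha> t) (at t within I)"
    using * v by simp
qed

lemma regular_curve_derivatives:
  assumes "is_interval I" "interior I \<noteq> {}" "regular_curve I \<alpha>"
  shows "\<And>t. t \<in> I \<Longrightarrow> (\<alpha> has_vector_derivative velocity I \<alpha> t) (at t within I)"
    and "\<And>t. t \<in> I \<Longrightarrow> (velocity I \<alpha> has_vector_derivative acceleration I \<alpha> t) (at t within I)"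
    and "continuous_on I \<alpha>" "continuous_on I (velocity I \<alpha>)" "continuous_on I (acceleration I \<alpha>)"
proof -
  have 2: "Ck_on (Suc (Suc 0)) I \<alpha>"
    using assms(3) by (simp only: regular_curve_def numeral_2_eq_2)
  note 1 = Ck_on_Suc_velocity[OF assms(1,2) 2]
  note 0 = Ck_on_Suc_velocity[OF assms(1,2) 1(1)]
  show "\<And>t. t \<in> I \<Longrightarrow> (\<alpha> has_vector_derivative velocity I \<alpha> t) (at t within I)" by (rule 1)
  show "\<And>t. t \<in> I \<Longrightarrow> (velocity I \<alpha> has_vector_derivative acceleration I \<alpha> t) (at t within I)"
    unfolding acceleration_def by (rule 0)
  show "continuous_on I \<alpha>" "continuous_on I (velocity I \<alpha>)" "continuous_on I (acceleration I \<alpha>)"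
    using 2 1(1) 0(1) Ck_on_imp_continuous_on unfolding acceleration_def by blast+
qed

text \<open>The fundamental theorem of calculus is applied on a compact \<open>{a..b}\<close> inside
  \<open>I\<close> that contains \<open>c\<close> and \<open>x\<close> and agrees with
  \<open>I\<close> near \<open>x\<close>. This covers open, half-open and unbounded intervals at
  once, and both orders of \<open>c\<close> and \<open>x\<close>.\<close>

lemma interval_integral_has_vector_derivative:
  fixes f :: "real \<Rightarrow> 'a::euclidean_space"
  assumes I: "is_interval I" and f: "continuous_on I f" and c: "c \<in> I" and x: "x \<in> I"
  shows "((\<lambda>u. LBINT y=c..u. f y) has_vector_derivative f x) (at x within I)"
proof -
  \<comment> \<open>The point \<open>a\<close> lies strictly left of \<open>x\<close> unless
    \<open>x\<close> is the least element of \<open>I\<close>, in which case \<open>a = x\<close>.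
    In the neighbourhood \<open>L\<close> of \<open>x\<close> no point of \<open>I\<close> lies
    below \<open>a\<close>.\<close>
  obtain a L where a: "a \<in> I" "a \<le> x" "a \<le> c" "open L" "x \<in> L" "\<And>u. u \<in> I \<Longrightarrow> u \<in> L \<Longrightarrow> a \<le> u"
  proof (cases "\<exists>y\<in>I. y < x")
    case True
    then obtain y where "y \<in> I" "y < x" by auto
    then show ?thesis using that[of "min y c" "{y<..}"] c by (auto simp: min_def)
  next
    case False
    then show ?thesis using that[of x UNIV] c x by (auto simp: not_less)
  qed
  obtain b R where b: "b \<in> I" "x \<le> b" "c \<le> b" "open R" "x \<in> R" "\<And>u. u \<in> I \<Longrightarrow> u \<in> R \<Longrightarrow> u \<le> b"
  proof (cases "\<exists>y\<in>I. x < y")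
    case True
    then obtain y where "y \<in> I" "x < y" by auto
    then show ?thesis using that[of "max y c" "{..<y}"] c by (auto simp: max_def)
  next
    case False
    then show ?thesis using that[of x UNIV] c x by (auto simp: not_less)
  qed
  have sub: "{a..b} \<subseteq> I" using I a(1) b(1) unfolding is_interval_1 by fastforce
  have "((\<lambda>u. LBINT y=c..u. f y) has_vector_derivative f x) (at x within {a..b})"
    by (intro interval_integral_FTC2 continuous_on_subset[OF f sub] a(2,3) b(2,3))
  moreover have "at x within I = at x within {a..b}"
  proof (rule at_within_nhd[of x "L \<inter> R"])
    show "I \<inter> (L \<inter> R) - {x} = {a..b} \<inter> (L \<inter> R) - {x}"
      using a(6) b(6) sub by auto
  qed (use a(4,5) b(4,5) in auto)
  ultimately show ?thesis by simp
qed


subsection \<open>A class of surfaces closed under partial derivatives\<close>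

text \<open>The shape of \<alpha> * \<omega>, with the two integrals as \<open>a\<close> and
  \<open>w\<close>. A derivative in the first variable keeps this shape with \<open>w\<close>
  replaced by 0, one in the second variable with \<open>a\<close> replaced by 0.\<close>

definition separated_map ::
  "(real \<Rightarrow> complex) \<Rightarrow> (real \<Rightarrow> complex) \<Rightarrow> (real \<Rightarrow> complex) \<Rightarrow> (real \<Rightarrow> complex)
    \<Rightarrow> real \<times> real \<Rightarrow> complex \<times> complex" where
  "separated_map a w u v p = (w (snd p) - a (fst p), u (fst p) * v (snd p))"

text \<open>Agreement of \<open>F\<close> with a separated map is asked only along the line through
  \<open>p\<close>. The rule can therefore be iterated, since a first partial derivative is known
  only on the rectangle.\<close>

lemma partial1_separated_map:
  assumes I: "is_interval I" "interior I \<noteq> {}" and p: "fst p \<in> I"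
    and F: "\<And>t. t \<in> I \<Longrightarrow> F (t, snd p) = separated_map a w u v (t, snd p)"
    and a: "(a has_vector_derivative a' (fst p)) (at (fst p) within I)"
    and u: "(u has_vector_derivative u' (fst p)) (at (fst p) within I)"
  shows "partial1 I F p = separated_map a' (\<lambda>_. 0) u' v p"
  unfolding partial1_def
proof (rule vector_derivative_within[OF at_within_interval_neq_bot[OF I p]])
  have "((\<lambda>t. separated_map a w u v (t, snd p)) has_vector_derivative
      separated_map a' (\<lambda>_. 0) u' v p) (at (fst p) within I)"
    unfolding separated_map_def by (auto intro!: derivative_eq_intros has_vector_derivative_Pair a u)
  then show "((\<lambda>t. F (t, snd p)) has_vector_derivative
      separated_map a' (\<lambda>_. 0) u' v p) (at (fst p) within I)"
    by (rule has_vector_derivative_transform[OF p F, rotated])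
qed

lemma partial2_separated_map:
  assumes J: "is_interval J" "interior J \<noteq> {}" and p: "snd p \<in> J"
    and F: "\<And>s. s \<in> J \<Longrightarrow> F (fst p, s) = separated_map a w u v (fst p, s)"
    and w: "(w has_vector_derivative w' (snd p)) (at (snd p) within J)"
    and v: "(v has_vector_derivative v' (snd p)) (at (snd p) within J)"
  shows "partial2 J F p = separated_map (\<lambda>_. 0) w' u v' p"
  unfolding partial2_def
proof (rule vector_derivative_within[OF at_within_interval_neq_bot[OF J p]])
  have "((\<lambda>s. separated_map a w u v (fst p, s)) has_vector_derivative
      separated_map (\<lambda>_. 0) w' u v' p) (at (snd p) within J)"
    unfolding separated_map_def by (auto intro!: derivative_eq_intros has_vector_derivative_Pair w v)
  then show "((\<lambda>s. F (fst p, s)) has_vector_derivative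
      separated_map (\<lambda>_. 0) w' u v' p) (at (snd p) within J)"
    by (rule has_vector_derivative_transform[OF p F, rotated])
qed

lemma has_derivative_fst_snd:
  assumes "p \<in> I \<times> J"
  shows "(f has_vector_derivative f') (at (fst p) within I) \<Longrightarrow>
      ((\<lambda>q. f (fst q)) has_derivative (\<lambda>h. fst h *\<^sub>R f')) (at p within I \<times> J)"
    and "(f has_vector_derivative f') (at (snd p) within J) \<Longrightarrow>
      ((\<lambda>q. f (snd q)) has_derivative (\<lambda>h. snd h *\<^sub>R f')) (at p within I \<times> J)"
proof -
  assume "(f has_vector_derivative f') (at (fst p) within I)"
  \<comment> \<open>The chain rule along the projection takes the outer derivative within the image
    of the rectangle, which is contained in \<open>I\<close>.\<close>
  then have "(f has_derivative (\<lambda>h. h *\<^sub>R f')) (at (fst p) within fst ` (I \<times> J))"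
    unfolding has_vector_derivative_def by (rule has_derivative_subset) auto
  from has_derivative_in_compose[OF has_derivative_fst[OF has_derivative_ident] this]
  show "((\<lambda>q. f (fst q)) has_derivative (\<lambda>h. fst h *\<^sub>R f')) (at p within I \<times> J)" by simp
next
  assume "(f has_vector_derivative f') (at (snd p) within J)"
  then have "(f has_derivative (\<lambda>h. h *\<^sub>R f')) (at (snd p) within snd ` (I \<times> J))"
    unfolding has_vector_derivative_def by (rule has_derivative_subset) auto
  from has_derivative_in_compose[OF has_derivative_snd[OF has_derivative_ident] this]
  show "((\<lambda>q. f (snd q)) has_derivative (\<lambda>h. snd h *\<^sub>R f')) (at p within I \<times> J)" by simp
qed

lemma separated_map_has_derivative:
  assumes p: "p \<in> I \<times> J"
    and a: "(a has_vector_derivative a' (fst p)) (at (fst p) within I)"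
    and w: "(w has_vector_derivative w' (snd p)) (at (snd p) within J)"
    and u: "(u has_vector_derivative u' (fst p)) (at (fst p) within I)"
    and v: "(v has_vector_derivative v' (snd p)) (at (snd p) within J)"
  shows "(separated_map a w u v has_derivative
      (\<lambda>h. fst h *\<^sub>R separated_map a' (\<lambda>_. 0) u' v p + snd h *\<^sub>R separated_map (\<lambda>_. 0) w' u v' p))
      (at p within I \<times> J)"
proof -
  have "((\<lambda>q. (w (snd q) - a (fst q), u (fst q) * v (snd q))) has_derivative
      (\<lambda>h. (snd h *\<^sub>R w' (snd p) - fst h *\<^sub>R a' (fst p),
        u (fst p) * (snd h *\<^sub>R v' (snd p)) + fst h *\<^sub>R u' (fst p) * v (snd p)))) (at p within I \<times> J)"
    by (intro has_derivative_Pair has_derivative_diff has_derivative_mult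
        has_derivative_fst_snd[OF p] a w u v)
  then show ?thesis
    by (simp add: separated_map_def[abs_def] algebra_simps)
qed

text \<open>On the basis vectors (1,0) and (0,1) the differential takes the values of the two
  partial derivatives, which are separated maps again; smoothness is thus reduced by one order at a
  time.\<close>

lemma Ck_on_Suc_separated_map:
  assumes "\<And>t. t \<in> I \<Longrightarrow> (a has_vector_derivative a' t) (at t within I)"
    and "\<And>s. s \<in> J \<Longrightarrow> (w has_vector_derivative w' s) (at s within J)"
    and "\<And>t. t \<in> I \<Longrightarrow> (u has_vector_derivative u' t) (at t within I)"
    and "\<And>s. s \<in> J \<Longrightarrow> (v has_vector_derivative v' s) (at s within J)"
    and "Ck_on k (I \<times> J) (separated_map a' (\<lambda>_. 0) u' v)"
    and "Ck_on k (I \<times> J) (separated_map (\<lambda>_. 0) w' u v')"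
  shows "Ck_on (Suc k) (I \<times> J) (separated_map a w u v)"
proof -
  let ?D = "\<lambda>p h. fst h *\<^sub>R separated_map a' (\<lambda>_. 0) u' v p
    + snd h *\<^sub>R separated_map (\<lambda>_. 0) w' u v' p"
  have "(separated_map a w u v has_derivative ?D p) (at p within I \<times> J)" if "p \<in> I \<times> J" for p
    using that by (intro separated_map_has_derivative assms) auto
  moreover have "Ck_on k (I \<times> J) (\<lambda>p. ?D p b)" if "b \<in> Basis" for b :: "real \<times> real"
    using that assms(5,6) by (auto simp: Basis_prod_def)
  ultimately show ?thesis by (auto intro!: exI[of _ ?D])
qed

lemma continuous_on_separated_map:
  assumes "continuous_on I a" "continuous_on J w" "continuous_on I u" "continuous_on J v"
  shows "continuous_on (I \<times> J) (separated_map a w u v)"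
  unfolding separated_map_def
  by (intro continuous_intros continuous_on_compose2[OF assms(1)] continuous_on_compose2[OF assms(2)]
      continuous_on_compose2[OF assms(3)] continuous_on_compose2[OF assms(4)]) auto


subsection \<open>Normal projections\<close>

lemma subspace_tangent_space: "subspace (tangent_space I J F p)"
  by (simp add: tangent_space_def)

text \<open>The difference of two candidates is both normal and tangent, hence orthogonal to itself
  and zero.\<close>

lemma normal_projection_eqI:
  assumes "n \<in> (tangent_space I J F p)\<^sup>\<bottom>" "v - n \<in> tangent_space I J F p"
  shows "normal_projection I J F p v = n"
  unfolding normal_projection_def
proof (rule the_equality)
  fix m assume m: "m \<in> (tangent_space I J F p)\<^sup>\<bottom> \<and> v - m \<in> tangent_space I J F p"
  have "m - n \<in> (tangent_space I J F p)\<^sup>\<bottom>"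
    using m assms by (simp add: subspace_diff subspace_orthogonal_comp)
  moreover have "m - n \<in> tangent_space I J F p"
    using subspace_diff[OF subspace_tangent_space assms(2) conjunct2[OF m]] by simp
  ultimately have "(m - n) \<bullet> (m - n) = 0"
    by (auto simp: orthogonal_comp_def orthogonal_def)
  then show "m = n" by simp
qed (use assms in auto)

lemma normal_projection_mem:
  "normal_projection I J F p v \<in> (tangent_space I J F p)\<^sup>\<bottom>"
  "v - normal_projection I J F p v \<in> tangent_space I J F p"
proof -
  have s: "span (tangent_space I J F p) = tangent_space I J F p"
    using subspace_tangent_space by (simp only: span_eq_iff)
  obtain y z where y: "y \<in> tangent_space I J F p"
    and z: "\<And>w. w \<in> tangent_space I J F p \<Longrightarrow> orthogonal z w" and v: "v = y + z"
    using orthogonal_subspace_decomp_exists[of "tangent_space I J F p" v] unfolding s by blast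
  have "normal_projection I J F p v = z"
    using y z v by (intro normal_projection_eqI) (auto simp: orthogonal_comp_def orthogonal_commute)
  then show "normal_projection I J F p v \<in> (tangent_space I J F p)\<^sup>\<bottom>"
    "v - normal_projection I J F p v \<in> tangent_space I J F p"
    using y z v by (auto simp: orthogonal_comp_def orthogonal_commute)
qed

text \<open>This turns the soliton equation, an equality of two normal parts, into tangency of a
  single vector.\<close>

lemma normal_projection_eq_iff:
  "normal_projection I J F p v = normal_projection I J F p w \<longleftrightarrow> v - w \<in> tangent_space I J F p"
proof
  assume "normal_projection I J F p v = normal_projection I J F p w"
  then show "v - w \<in> tangent_space I J F p"
    using subspace_diff[OF subspace_tangent_space normal_projection_mem(2)[of v I J F p]
        normal_projection_mem(2)[of w I J F p]] by simp
next
  assume "v - w \<in> tangent_space I J F p"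
  then have "v - normal_projection I J F p w \<in> tangent_space I J F p"
    using subspace_add[OF subspace_tangent_space _ normal_projection_mem(2)[of w I J F p], of "v - w"]
    by simp
  then show "normal_projection I J F p v = normal_projection I J F p w"
    by (intro normal_projection_eqI normal_projection_mem)
qed

text \<open>For a diagonal metric the mixed term disappears and the inverse metric has entries
  \<open>1 / g11\<close> and \<open>1 / g22\<close>. The weighted sum of normal parts is normal and
  differs from the weighted sum of second derivatives by a tangent vector, so it is the normal part
  of that sum.\<close>

lemma mean_curvature_vector_orthogonal:
  fixes F :: "real \<times> real \<Rightarrow> 'b::euclidean_space"
  assumes X: "partial1 I F p \<noteq> 0" and Y: "partial2 J F p \<noteq> 0"
    and XY: "partial1 I F p \<bullet> partial2 J F p = 0"
  shows "mean_curvature_vector I J F p = normal_projection I J F p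
    (partial1 I (partial1 I F) p /\<^sub>R (partial1 I F p \<bullet> partial1 I F p)
      + partial2 J (partial2 J F) p /\<^sub>R (partial2 J F p \<bullet> partial2 J F p))"
proof -
  let ?g1 = "partial1 I F p \<bullet> partial1 I F p" and ?g2 = "partial2 J F p \<bullet> partial2 J F p"
  let ?N = "normal_projection I J F p" and ?T = "tangent_space I J F p"
  let ?A = "partial1 I (partial1 I F) p" and ?B = "partial2 J (partial2 J F) p"
  have g: "inverse ?g1 * inverse ?g2 * ?g2 = inverse ?g1" "inverse ?g1 * inverse ?g2 * ?g1 = inverse ?g2"
    using X Y by (simp_all add: field_simps)
  have "mean_curvature_vector I J F p = ?N ?A /\<^sub>R ?g1 + ?N ?B /\<^sub>R ?g2"
    using XY by (simp add: mean_curvature_vector_def Let_def scaleR_add_right g)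
  moreover have "?N ?A /\<^sub>R ?g1 + ?N ?B /\<^sub>R ?g2 \<in> ?T\<^sup>\<bottom>"
    by (intro subspace_add subspace_scale subspace_orthogonal_comp normal_projection_mem)
  moreover have "(?A - ?N ?A) /\<^sub>R ?g1 + (?B - ?N ?B) /\<^sub>R ?g2 \<in> ?T"
    by (intro subspace_add subspace_scale subspace_tangent_space normal_projection_mem)
  ultimately show ?thesis
    using normal_projection_eqI[of "?N ?A /\<^sub>R ?g1 + ?N ?B /\<^sub>R ?g2" I J F p "?A /\<^sub>R ?g1 + ?B /\<^sub>R ?g2"]
    by (simp add: algebra_simps)
qed


subsection \<open>Linear algebra of the Lagrangian tangent planes\<close>

lemma inner_Pair_complex:
  fixes x y :: "complex \<times> complex"
  shows "x \<bullet> y = Re (fst x * cnj (fst y)) + Re (snd x * cnj (snd y))"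
  by (simp add: inner_prod_def inner_complex_def)

text \<open>
  The two imaginary parts are, up to positive factors, those of the complex coefficients of \<open>V\<close> with
  respect to the Hermitian orthogonal vectors spanning the plane.
\<close>

lemma in_span_Lagrangian_plane_iff:
  fixes a b c d :: complex and V :: "complex \<times> complex"
  assumes a: "a \<noteq> 0" and b: "b \<noteq> 0" and c: "c \<noteq> 0"
  shows "V \<in> span {(- (a * cnj c), a * d), (b * cnj d, c * b)} \<longleftrightarrow>
    Im ((snd V * cnj d - fst V * c) * cnj a) = 0 \<and> Im ((fst V * d + snd V * cnj c) * cnj b) = 0"
    (is "V \<in> span {?X, ?Y} \<longleftrightarrow> ?P \<and> ?Q")
proof
  assume "V \<in> span {?X, ?Y}"
  then obtain k where "V - k *\<^sub>R ?X \<in> span {?Y}" by (auto simp: span_insert)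
  then obtain l where "V - k *\<^sub>R ?X = l *\<^sub>R ?Y" by (auto simp: span_singleton)
  then have V: "V = k *\<^sub>R ?X + l *\<^sub>R ?Y" by (simp add: algebra_simps)
  \<comment> \<open>The left side is the Hermitian product of \<open>V\<close> with
    \<open>?X\<close>. Hermitian orthogonality removes the \<open>?Y\<close> part and leaves
    \<open>k\<close> times the squared length of \<open>?X\<close>, a real number; likewise below
    for \<open>?Y\<close>.\<close>
  have "(snd V * cnj d - fst V * c) * cnj a = of_real k * (a * cnj a) * (c * cnj c + d * cnj d)"
    unfolding V by (simp add: scaleR_conv_of_real algebra_simps)
  moreover have "(fst V * d + snd V * cnj c) * cnj b = of_real l * (b * cnj b) * (c * cnj c + d * cnj d)"
    unfolding V by (simp add: scaleR_conv_of_real algebra_simps)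
  ultimately show "?P \<and> ?Q"
    by (simp only: complex_mult_cnj flip: of_real_add of_real_mult of_real_power) simp
next
  assume PQ: "?P \<and> ?Q"
  define n where "n = (cmod c)\<^sup>2 + (cmod d)\<^sup>2"
  have n: "n > 0" using c by (simp add: n_def add_pos_nonneg)
  have N: "of_real n = c * cnj c + d * cnj d" by (simp only: n_def of_real_add complex_norm_square)
  \<comment> \<open>The coefficients are the Hermitian products of \<open>V\<close> with
    \<open>?X\<close> and \<open>?Y\<close> divided by the squared lengths. Taking real parts loses
    nothing because the imaginary parts vanish by \<open>PQ\<close>.\<close>
  define k where "k = Re ((snd V * cnj d - fst V * c) * cnj a) / ((cmod a)\<^sup>2 * n)"
  define l where "l = Re ((fst V * d + snd V * cnj c) * cnj b) / ((cmod b)\<^sup>2 * n)"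
  have "of_real (k * ((cmod a)\<^sup>2 * n)) = (snd V * cnj d - fst V * c) * cnj a"
    using PQ a n by (simp add: k_def complex_eq_iff)
  then have "cnj a * (of_real k * a * of_real n) = cnj a * (snd V * cnj d - fst V * c)"
    by (simp add: complex_norm_square algebra_simps del: of_real_power)
  then have k: "of_real k * a * of_real n = snd V * cnj d - fst V * c"
    using a by simp
  have "of_real (l * ((cmod b)\<^sup>2 * n)) = (fst V * d + snd V * cnj c) * cnj b"
    using PQ b n by (simp add: l_def complex_eq_iff)
  then have "cnj b * (of_real l * b * of_real n) = cnj b * (fst V * d + snd V * cnj c)"
    by (simp add: complex_norm_square algebra_simps del: of_real_power)
  then have l: "of_real l * b * of_real n = fst V * d + snd V * cnj c"
    using b by simp
  \<comment> \<open>Expansion of \<open>V\<close> in the Hermitian orthogonal vectors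
    \<open>(- cnj c, d)\<close> and \<open>(cnj d, c)\<close>, both of squared length
    \<open>n\<close>.\<close>
  have "fst V * of_real n = (- (of_real k * a * of_real n)) * cnj c + (of_real l * b * of_real n) * cnj d"
    unfolding k l unfolding N by (simp add: algebra_simps)
  then have "of_real n * fst V = of_real n * (of_real k * (- (a * cnj c)) + of_real l * (b * cnj d))"
    by (simp add: algebra_simps)
  moreover have "snd V * of_real n = (of_real k * a * of_real n) * d + (of_real l * b * of_real n) * c"
    unfolding k l unfolding N by (simp add: algebra_simps)
  then have "of_real n * snd V = of_real n * (of_real k * (a * d) + of_real l * (c * b))"
    by (simp add: algebra_simps)
  ultimately have "V = k *\<^sub>R ?X + l *\<^sub>R ?Y"
    using n by (simp add: prod_eq_iff scaleR_conv_of_real del: mult_minus_right)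
  then show "V \<in> span {?X, ?Y}"
    by (simp only:) (intro span_add span_scale span_base; simp)
qed

text \<open>The soliton equation at one point: \<open>c, a, a2\<close> stand for \<alpha> and its
  first two derivatives, \<open>d, b, b2\<close> for those of \<omega>. Each tangency condition
  involves only one of the curves, because the second derivative of the other one contributes only
  along the other tangent vector and the squared speeds, divided by the metric coefficients,
  cancel.\<close>

lemma soliton_vector_in_span_iff:
  fixes a b c d a2 b2 e :: complex
  assumes a: "a \<noteq> 0" and b: "b \<noteq> 0" and c: "c \<noteq> 0"
  defines "X \<equiv> (- (a * cnj c), a * d)" and "Y \<equiv> (b * cnj d, c * b)"
  shows "(- (a2 * cnj c + a * cnj a), a2 * d) /\<^sub>R (X \<bullet> X) + (b2 * cnj d + b * cnj b, c * b2) /\<^sub>R (Y \<bullet> Y) - (e, 0)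
      \<in> span {X, Y} \<longleftrightarrow>
    Im (cnj a * a2) / (cmod a)\<^sup>2 = Im (cnj e * a * cnj c) \<and>
    Im (cnj b * b2) / (cmod b)\<^sup>2 = - Im (cnj e * b * cnj d)"
    (is "?V \<in> _ \<longleftrightarrow> _")
proof -
  define n where "n = (cmod c)\<^sup>2 + (cmod d)\<^sup>2"
  have n: "n > 0" using c by (simp add: n_def add_pos_nonneg)
  have N: "of_real n = c * cnj c + d * cnj d" by (simp only: n_def of_real_add complex_norm_square)
  have XX: "X \<bullet> X = (cmod a)\<^sup>2 * n" and YY: "Y \<bullet> Y = (cmod b)\<^sup>2 * n"
    unfolding X_def Y_def n_def inner_prod_def power2_norm_eq_inner[symmetric]
    by (simp_all add: norm_mult power_mult_distrib algebra_simps)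
  define g where "g = complex_of_real ((cmod a)\<^sup>2 * n)"
  define h where "h = complex_of_real ((cmod b)\<^sup>2 * n)"
  have g: "g = a * cnj a * (c * cnj c + d * cnj d)" "g \<noteq> 0"
    using a n by (simp_all only: g_def of_real_mult complex_norm_square N) (simp_all flip: N)
  have h: "h = b * cnj b * (c * cnj c + d * cnj d)" "h \<noteq> 0"
    using b n by (simp_all only: h_def of_real_mult complex_norm_square N) (simp_all flip: N)
  have V: "fst ?V = - (a2 * cnj c + a * cnj a) / g + (b2 * cnj d + b * cnj b) / h - e"
    "snd ?V = a2 * d / g + c * b2 / h"
    unfolding XX YY g_def h_def by (simp_all add: scaleR_conv_of_real field_simps)
  \<comment> \<open>Both quotients equal \<open>1 / n\<close>, as the metric coefficients are the
    squared speeds times the common factor \<open>n\<close>.\<close>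
  have gh: "a * cnj a / g = b * cnj b / h"
    using a b g(2) h(2) by (simp add: frac_eq_eq g(1) h(1))
  \<comment> \<open>The terms with \<open>b2\<close> cancel, since \<open>(cnj d, c)\<close> is
    Hermitian orthogonal to \<open>X\<close>. The middle term vanishes by \<open>gh\<close>.\<close>
  have "(snd ?V * cnj d - fst ?V * c) * cnj a
      = (cnj a * a2) * ((c * cnj c + d * cnj d) / g) + c * (a * cnj a / g - b * cnj b / h) * cnj a + e * c * cnj a"
    unfolding V by (simp add: algebra_simps add_divide_distrib diff_divide_distrib)
  also have "(c * cnj c + d * cnj d) / g = of_real (1 / (cmod a)\<^sup>2)"
    using n by (simp add: g_def flip: N)
  finally have 1: "Im ((snd ?V * cnj d - fst ?V * c) * cnj a)
      = Im (cnj a * a2) / (cmod a)\<^sup>2 + Im (e * c * cnj a)"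
    unfolding gh by (simp del: of_real_divide add: mult.assoc diff_divide_distrib)
  have "(fst ?V * d + snd ?V * cnj c) * cnj b
      = (cnj b * b2) * ((c * cnj c + d * cnj d) / h) + d * (b * cnj b / h - a * cnj a / g) * cnj b - e * d * cnj b"
    unfolding V by (simp add: algebra_simps add_divide_distrib diff_divide_distrib)
  also have "(c * cnj c + d * cnj d) / h = of_real (1 / (cmod b)\<^sup>2)"
    using n by (simp add: h_def flip: N)
  finally have 2: "Im ((fst ?V * d + snd ?V * cnj c) * cnj b)
      = Im (cnj b * b2) / (cmod b)\<^sup>2 - Im (e * d * cnj b)"
    unfolding gh by (simp del: of_real_divide add: mult.assoc diff_divide_distrib)
  have "Im (e * c * cnj a) = - Im (cnj e * a * cnj c)" "Im (e * d * cnj b) = - Im (cnj e * b * cnj d)"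
    by (simp_all add: algebra_simps)
  then show ?thesis
    unfolding X_def Y_def in_span_Lagrangian_plane_iff[OF a b c]
    unfolding 1[unfolded X_def Y_def] 2[unfolded X_def Y_def] by auto
qed

text \<open>The derivative of the argument of the velocity, in the form that the tangency condition
  produces. For zero velocity both sides are 0 by the convention for division.\<close>

lemma norm_mult_signed_curvature:
  "norm (velocity I \<alpha> t) * signed_curvature I \<alpha> t
    = Im (cnj (velocity I \<alpha> t) * acceleration I \<alpha> t) / (norm (velocity I \<alpha> t))\<^sup>2"
  by (simp add: signed_curvature_def power2_eq_square power3_eq_cube)

text \<open>Inner products with \<open>X\<close> and \<open>Y\<close> recover the two coefficients.
  Applied to the differential of \<Phi>, this gives the immersion property.\<close>

lemma inj_orthogonal_combination:
  fixes X Y :: "'b::real_inner"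
  assumes "X \<noteq> 0" "Y \<noteq> 0" "X \<bullet> Y = 0"
  shows "inj (\<lambda>h :: real \<times> real. fst h *\<^sub>R X + snd h *\<^sub>R Y)"
proof (rule injI)
  fix h k :: "real \<times> real"
  assume eq: "fst h *\<^sub>R X + snd h *\<^sub>R Y = fst k *\<^sub>R X + snd k *\<^sub>R Y"
  show "h = k"
    using arg_cong[OF eq, of "\<lambda>V. V \<bullet> X"] arg_cong[OF eq, of "\<lambda>V. V \<bullet> Y"] assms
      inner_commute[of Y X]
    by (simp add: inner_add_left prod_eq_iff)
qed

theorem corollary3p6:
  fixes \<alpha> \<omega> :: "real \<Rightarrow> complex" and I1 I2 :: "real set" and t0 s0 \<rho> \<theta> :: real
  assumes "is_interval I1" and "interior I1 \<noteq> {}"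
    and "is_interval I2" and "interior I2 \<noteq> {}"
    and "regular_curve I1 \<alpha>" and "\<forall>t\<in>I1. \<alpha> t \<noteq> 0"
    and "regular_curve I2 \<omega>" and "\<forall>s\<in>I2. \<omega> s \<noteq> 0"
    and "t0 \<in> I1" and "s0 \<in> I2"
    and "\<rho> > 0"
  shows "translating_soliton I1 I2 (curve_product I1 I2 t0 s0 \<alpha> \<omega>) (of_real \<rho> * cis \<theta>, 0) \<longleftrightarrow>
    (\<forall>t\<in>I1. norm (velocity I1 \<alpha> t) * signed_curvature I1 \<alpha> t
              = \<rho> * Im (cis (- \<theta>) * velocity I1 \<alpha> t * cnj (\<alpha> t))) \<and>
    (\<forall>s\<in>I2. norm (velocity I2 \<omega> s) * signed_curvature I2 \<omega> s
              = - \<rho> * Im (cis (- \<theta>) * velocity I2 \<omega> s * cnj (\<omega> s)))"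
proof -
  note I = assms(1,2) and J = assms(3,4)
  note A = regular_curve_derivatives[OF I assms(5)]
  note O = regular_curve_derivatives[OF J assms(7)]
  let ?a = "velocity I1 \<alpha>" and ?a2 = "acceleration I1 \<alpha>"
  let ?b = "velocity I2 \<omega>" and ?b2 = "acceleration I2 \<omega>"
  let ?\<Phi> = "curve_product I1 I2 t0 s0 \<alpha> \<omega>"

  \<comment> \<open>Partial derivatives of \<Phi> up to second order\<close>
  define f where "f = (\<lambda>t. ?a t * cnj (\<alpha> t))"
  define f' where "f' = (\<lambda>t. ?a2 t * cnj (\<alpha> t) + ?a t * cnj (?a t))"
  define g where "g = (\<lambda>s. ?b s * cnj (\<omega> s))"
  define g' where "g' = (\<lambda>s. ?b2 s * cnj (\<omega> s) + ?b s * cnj (?b s))"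
  define P where "P = separated_map f (\<lambda>_. 0) ?a \<omega>"
  define Q where "Q = separated_map (\<lambda>_. 0) g \<alpha> ?b"
  have f: "continuous_on I1 f" "continuous_on I1 f'"
    unfolding f_def f'_def by (intro continuous_intros A)+
  have g: "continuous_on I2 g" "continuous_on I2 g'"
    unfolding g_def g'_def by (intro continuous_intros O)+
  have df: "(f has_vector_derivative f' t) (at t within I1)" if "t \<in> I1" for t
    unfolding f_def f'_def
    using has_vector_derivative_mult[OF A(2)[OF that] has_vector_derivative_cnj[OF A(1)[OF that]]]
    by (simp add: add.commute)
  have dg: "(g has_vector_derivative g' s) (at s within I2)" if "s \<in> I2" for s
    unfolding g_def g'_def
    using has_vector_derivative_mult[OF O(2)[OF that] has_vector_derivative_cnj[OF O(1)[OF that]]]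
    by (simp add: add.commute)
  define F where "F = (\<lambda>u::real. LBINT x=t0..u. f x)"
  define G where "G = (\<lambda>u::real. LBINT y=s0..u. g y)"
  have dF: "(F has_vector_derivative f t) (at t within I1)" if "t \<in> I1" for t
    unfolding F_def by (intro interval_integral_has_vector_derivative I f assms that)
  have dG: "(G has_vector_derivative g s) (at s within I2)" if "s \<in> I2" for s
    unfolding G_def by (intro interval_integral_has_vector_derivative J g assms that)
  have \<Phi>: "?\<Phi> = separated_map F G \<alpha> \<omega>"
    by (auto simp: curve_product_def separated_map_def F_def G_def f_def g_def fun_eq_iff)
  have zero: "((\<lambda>_. 0::complex) has_vector_derivative 0) net" for net by simp
  have P1: "partial1 I1 ?\<Phi> p = P p" if "p \<in> I1 \<times> I2" for p
    unfolding P_def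
    by (rule partial1_separated_map[where a = F and u = \<alpha> and w = G, OF I])
      (use that in \<open>auto simp: \<Phi> intro: dF A\<close>)
  have P2: "partial2 I2 ?\<Phi> p = Q p" if "p \<in> I1 \<times> I2" for p
    unfolding Q_def
    by (rule partial2_separated_map[where w = G and v = \<omega> and a = F, OF J])
      (use that in \<open>auto simp: \<Phi> intro: dG O\<close>)
  \<comment> \<open>Only the pure second derivatives are computed: the mixed one enters the mean
    curvature vector with the factor \<open>P p \<bullet> Q p\<close>, which is shown to be 0
    below.\<close>
  have P11: "partial1 I1 (partial1 I1 ?\<Phi>) p = separated_map f' (\<lambda>_. 0) ?a2 \<omega> p"
    if "p \<in> I1 \<times> I2" for p
    by (rule partial1_separated_map[where a = f and u = ?a and w = "\<lambda>_. 0", OF I])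
      (use that in \<open>auto simp: P1 P_def intro: df A\<close>)
  have P22: "partial2 I2 (partial2 I2 ?\<Phi>) p = separated_map (\<lambda>_. 0) g' \<alpha> ?b2 p"
    if "p \<in> I1 \<times> I2" for p
    by (rule partial2_separated_map[where w = g and v = ?b and a = "\<lambda>_. 0", OF J])
      (use that in \<open>auto simp: P2 Q_def intro: dg O\<close>)
  have nz: "?a (fst p) \<noteq> 0" "?b (snd p) \<noteq> 0" "\<alpha> (fst p) \<noteq> 0" if "p \<in> I1 \<times> I2" for p
    using assms that by (auto simp: regular_curve_def)
  \<comment> \<open>The two coordinates contribute opposite terms to the inner product. The first
    coordinate of \<open>P\<close> and the second one of \<open>Q\<close> are nonzero because
    \<alpha> and both velocities are.\<close>
  have PQ: "P p \<noteq> 0" "Q p \<noteq> 0" "P p \<bullet> Q p = 0" if "p \<in> I1 \<times> I2" for p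
    using nz[OF that]
    by (auto simp: P_def Q_def separated_map_def f_def g_def prod_eq_iff inner_Pair_complex algebra_simps)

  \<comment> \<open>The immersion property of \<Phi>\<close>
  have "Ck_on 2 (I1 \<times> I2) ?\<Phi>"
    \<comment> \<open>The reduction is used for \<Phi> and then for each of its two partial
      derivatives, which leaves continuity of the second ones.\<close>
    unfolding \<Phi> numeral_2_eq_2
    by (intro Ck_on_Suc_separated_map[OF dF dG A(1) O(1)]
        Ck_on_Suc_separated_map[OF df zero A(2) O(1)] Ck_on_Suc_separated_map[OF zero dg A(1) O(2)])
      (auto intro!: continuous_on_separated_map continuous_on_const A O f g)
  moreover have "(?\<Phi> has_derivative (\<lambda>h. fst h *\<^sub>R P p + snd h *\<^sub>R Q p)) (at p within I1 \<times> I2)"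
    if "p \<in> I1 \<times> I2" for p
    unfolding \<Phi> P_def Q_def using that by (intro separated_map_has_derivative dF dG A O) auto
  ultimately have imm: "immersion_on I1 I2 ?\<Phi>"
    unfolding immersion_on_def using inj_orthogonal_combination[OF PQ] by blast

  \<comment> \<open>The soliton equation at a point and on the whole rectangle\<close>
  let ?e = "(of_real \<rho> * cis \<theta>, 0) :: complex \<times> complex"
  have key: "mean_curvature_vector I1 I2 ?\<Phi> p = normal_projection I1 I2 ?\<Phi> p ?e \<longleftrightarrow>
      norm (?a t) * signed_curvature I1 \<alpha> t = \<rho> * Im (cis (- \<theta>) * ?a t * cnj (\<alpha> t)) \<and>
      norm (?b s) * signed_curvature I2 \<omega> s = - \<rho> * Im (cis (- \<theta>) * ?b s * cnj (\<omega> s))"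
    if p: "p = (t, s)" "t \<in> I1" "s \<in> I2" for p t s
  proof -
    have cis_eq: "Im (cnj (of_real \<rho> * cis \<theta>) * x * y) = \<rho> * Im (cis (- \<theta>) * x * y)" for x y
      by (simp add: cis_cnj mult.assoc)
    have pI: "p \<in> I1 \<times> I2" using p by simp
    have X: "P p = (- (?a t * cnj (\<alpha> t)), ?a t * \<omega> s)" and Y: "Q p = (?b s * cnj (\<omega> s), \<alpha> t * ?b s)"
      by (simp_all add: P_def Q_def separated_map_def f_def g_def p)
    have "mean_curvature_vector I1 I2 ?\<Phi> p = normal_projection I1 I2 ?\<Phi> p
        ((- f' t, ?a2 t * \<omega> s) /\<^sub>R (P p \<bullet> P p) + (g' s, \<alpha> t * ?b2 s) /\<^sub>R (Q p \<bullet> Q p))"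
      using mean_curvature_vector_orthogonal[of I1 ?\<Phi> p I2] PQ[OF pI]
      unfolding P11[OF pI] P22[OF pI] P1[OF pI] P2[OF pI] by (simp add: separated_map_def p)
    then have "mean_curvature_vector I1 I2 ?\<Phi> p = normal_projection I1 I2 ?\<Phi> p ?e \<longleftrightarrow>
        (- f' t, ?a2 t * \<omega> s) /\<^sub>R (P p \<bullet> P p) + (g' s, \<alpha> t * ?b2 s) /\<^sub>R (Q p \<bullet> Q p) - ?e
          \<in> span {P p, Q p}"
      by (simp add: normal_projection_eq_iff tangent_space_def P1[OF pI] P2[OF pI])
    also have "\<dots> \<longleftrightarrow>
        Im (cnj (?a t) * ?a2 t) / (cmod (?a t))\<^sup>2 = Im (cnj (of_real \<rho> * cis \<theta>) * ?a t * cnj (\<alpha> t)) \<and>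
        Im (cnj (?b s) * ?b2 s) / (cmod (?b s))\<^sup>2 = - Im (cnj (of_real \<rho> * cis \<theta>) * ?b s * cnj (\<omega> s))"
      unfolding X Y f'_def g'_def using nz[OF pI] p by (intro soliton_vector_in_span_iff) auto
    finally show ?thesis by (simp only: norm_mult_signed_curvature cis_eq mult_minus_left)
  qed
  have "?e \<noteq> 0" using assms(11) by (simp add: prod_eq_iff)
  then have "translating_soliton I1 I2 ?\<Phi> ?e \<longleftrightarrow> (\<forall>t\<in>I1. \<forall>s\<in>I2.
      norm (?a t) * signed_curvature I1 \<alpha> t = \<rho> * Im (cis (- \<theta>) * ?a t * cnj (\<alpha> t)) \<and>
      norm (?b s) * signed_curvature I2 \<omega> s = - \<rho> * Im (cis (- \<theta>) * ?b s * cnj (\<omega> s)))"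
    using imm key[OF refl] unfolding translating_soliton_def
    by (simp only: split_paired_Ball_Sigma simp_thms cong: ball_cong)
  \<comment> \<open>The pointwise condition joins one equation in \<open>t\<close> with one in
    \<open>s\<close>. The points \<open>t0\<close> and \<open>s0\<close> show that neither interval
    is empty, so the quantifiers separate.\<close>
  then show ?thesis using assms(9,10) by blast
qed

end
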